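(* Let $M$ be a monoid (i.e., a cancellative commutative semigroup with identity). The following conditions are equivalent. (a) $M$ is a hereditary BFM, i.e., every submonoid of $M$ is a bounded factorization monoid (BFM). (b) Every undermonoid of $M$ is a BFM.
   Context: "Monoid" means a cancellative and commutative semigroup with identity, written additively. $\mathcal{U}(M)$ is the group of invertible elements of $M$. $\operatorname{gp}(M)$ is the Grothendieck group of $M$ (the group of differences $\{x-y : x,y\in M\}$, in which $M$ embeds). A submonoid $N$ of $M$ is an undermonoid of $M$ if $\operatorname{gp}(N)=\operatorname{gp}(M)$, where $\operatorname{gp}(N)$ is identified with the subgroup of $\operatorname{gp}(M)$ generated by $N$. An atom of a monoid $M$ is an element $a\in M\setminus\mathcal{U}(M)$ such that whenever $a=b+c$ with $b,c\in M$, either $b\in\mathcal{U}(M)$ or $c\in\mathcal{U}(M)$; $\mathcal{A}(M)$ is the set of atoms of $M$. $M$ is atomic if every element of $M$ is invertible or a sum of finitely many atoms. For a monoid $M$, let $\mathsf{Z}(M)$ be the free commutative monoid on $\mathcal{A}(M/\mathcal{U}(M))$, and let $\phi\colon\mathsf{Z}(M)\to M/\mathcal{U}(M)$ be the monoid homomorphism that is the identity on $\mathcal{A}(M/\mathcal{U}(M))$. For $b\in M$, set $\mathsf{Z}(b)=\phi^{-1}(b+\mathcal{U}(M))$, and $\mathsf{L}(b)=\{|z| : z\in\mathsf{Z}(b)\}$, where $|z|$ is the number of atoms in the formal sum $z$ counted with multiplicity. $M$ is a bounded factorization monoid (BFM) if it is atomic and $1\le|\mathsf{L}(b)|<\infty$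 for all $b\in M$. *)

theory Defs
  imports "HOL-Algebra.Divisibility" "HOL-Algebra.Generated_Groups" "HOL-Algebra.FiniteProduct"
begin

text \<open>
  A monoid in the sense of this development is a \<^locale>\<open>comm_monoid_cancel\<close>. HOL-Algebra writes
  it multiplicatively: \<open>x \<otimes> y\<close> stands for $x + y$, \<open>\<one>\<close> for $0$, and \<^term>\<open>Units M\<close>
  for $\mathcal{U}(M)$. A submonoid \<open>N\<close> of \<open>M\<close> is a set, and
  \<open>M\<lparr>carrier := N\<rparr>\<close> is the corresponding monoid.
\<close>

section \<open>Grothendieck group and undermonoids\<close>

text \<open>The pair \<open>(x, y)\<close> represents the formal difference $x - y$.\<close>

definition diff_rel :: "('a, 'b) monoid_scheme \<Rightarrow> (('a \<times> 'a) \<times> ('a \<times> 'a)) set" where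
  "diff_rel M = {((x, y), (x', y')). x \<in> carrier M \<and> y \<in> carrier M \<and>
     x' \<in> carrier M \<and> y' \<in> carrier M \<and> x \<otimes>\<^bsub>M\<^esub> y' = x' \<otimes>\<^bsub>M\<^esub> y}"

definition diff_class :: "('a, 'b) monoid_scheme \<Rightarrow> 'a \<Rightarrow> 'a \<Rightarrow> ('a \<times> 'a) set" where
  "diff_class M x y = diff_rel M `` {(x, y)}"

definition gp :: "('a, 'b) monoid_scheme \<Rightarrow> ('a \<times> 'a) set monoid" where
  "gp M = \<lparr>carrier = (carrier M \<times> carrier M) // diff_rel M,
     monoid.mult = (\<lambda>P Q. \<Union>(x, y)\<in>P. \<Union>(x', y')\<in>Q. diff_class M (x \<otimes>\<^bsub>M\<^esub> x') (y \<otimes>\<^bsub>M\<^esub> y')),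
     one = diff_class M \<one>\<^bsub>M\<^esub> \<one>\<^bsub>M\<^esub>\<rparr>"

definition gp_embed :: "('a, 'b) monoid_scheme \<Rightarrow> 'a \<Rightarrow> ('a \<times> 'a) set" where
  "gp_embed M x = diff_class M x \<one>\<^bsub>M\<^esub>"

text \<open>\<open>gp(N)\<close> is identified with the subgroup of \<open>gp(M)\<close> generated by the image of \<open>N\<close>.\<close>

definition undermonoid :: "'a set \<Rightarrow> ('a, 'b) monoid_scheme \<Rightarrow> bool" where
  "undermonoid N M \<longleftrightarrow> submonoid N M \<and> generate (gp M) (gp_embed M ` N) = carrier (gp M)"

section \<open>Atoms, factorizations and bounded factorization monoids\<close>

definition atoms :: "('a, 'b) monoid_scheme \<Rightarrow> 'a set" where
  "atoms M = {a \<in> carrier M - Units M.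
     \<forall>b\<in>carrier M. \<forall>c\<in>carrier M. a = b \<otimes>\<^bsub>M\<^esub> c \<longrightarrow> b \<in> Units M \<or> c \<in> Units M}"

text \<open>The sum in \<open>M\<close> of a finite multiset of elements of \<open>M\<close>.\<close>

definition mset_val :: "('a, 'b) monoid_scheme \<Rightarrow> 'a multiset \<Rightarrow> 'a" where
  "mset_val M z = finprod M (\<lambda>a. a [^]\<^bsub>M\<^esub> count z a) (set_mset z)"

definition atomic_monoid :: "('a, 'b) monoid_scheme \<Rightarrow> bool" where
  "atomic_monoid M \<longleftrightarrow> (\<forall>x\<in>carrier M. x \<in> Units M \<or>
     (\<exists>z. set_mset z \<subseteq> atoms M \<and> x = mset_val M z))"

text \<open>
  The reduced monoid $M/\mathcal{U}(M)$ has the cosets of \<^term>\<open>Units M\<close> as elements. The free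
  commutative monoid on its atoms consists of the finite multisets of atoms, and
  \<^const>\<open>mset_val\<close> is its canonical homomorphism $\phi$ to $M/\mathcal{U}(M)$.
\<close>

definition reduced :: "('a, 'b) monoid_scheme \<Rightarrow> 'a set monoid" where
  "reduced M = M Mod Units M"

definition factorization_monoid :: "('a, 'b) monoid_scheme \<Rightarrow> 'a set multiset set" where
  "factorization_monoid M = {z. set_mset z \<subseteq> atoms (reduced M)}"

definition factorizations :: "('a, 'b) monoid_scheme \<Rightarrow> 'a \<Rightarrow> 'a set multiset set" where
  "factorizations M b =
     {z \<in> factorization_monoid M. mset_val (reduced M) z = Units M #>\<^bsub>M\<^esub> b}"

definition lengths :: "('a, 'b) monoid_scheme \<Rightarrow> 'a \<Rightarrow> nat set" where
  "lengths M b = size ` factorizations M b"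

definition bfm :: "('a, 'b) monoid_scheme \<Rightarrow> bool" where
  "bfm M \<longleftrightarrow> atomic_monoid M \<and>
     (\<forall>b\<in>carrier M. finite (lengths M b) \<and> 1 \<le> card (lengths M b))"

definition hereditary_bfm :: "('a, 'b) monoid_scheme \<Rightarrow> bool" where
  "hereditary_bfm M \<longleftrightarrow> (\<forall>N. submonoid N M \<longrightarrow> bfm (M\<lparr>carrier := N\<rparr>))"

section \<open>The constructions behave as intended\<close>

lemma (in comm_monoid_cancel) equiv_diff_rel:
  "equiv (carrier G \<times> carrier G) (diff_rel G)"
proof (rule equivI)
  show "trans (diff_rel G)"
  proof (rule transI)
    fix p q r assume "(p, q) \<in> diff_rel G" "(q, r) \<in> diff_rel G"
    then obtain x y x' y' x'' y'' where e: "p = (x, y)" "q = (x', y')" "r = (x'', y'')"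
      and c: "x \<in> carrier G" "y \<in> carrier G" "x' \<in> carrier G" "y' \<in> carrier G"
        "x'' \<in> carrier G" "y'' \<in> carrier G"
      and 1: "x \<otimes> y' = x' \<otimes> y" and 2: "x' \<otimes> y'' = x'' \<otimes> y'"
      by (auto simp: diff_rel_def)
    have "(x \<otimes> y'') \<otimes> y' = (x \<otimes> y') \<otimes> y''" using c by (simp add: m_ac)
    also have "\<dots> = (x' \<otimes> y'') \<otimes> y" using c 1 by (simp add: m_ac)
    also have "\<dots> = (x'' \<otimes> y) \<otimes> y'" using c 2 by (simp add: m_ac)
    finally have "x \<otimes> y'' = x'' \<otimes> y" using c by (metis m_closed r_cancel)
    then show "(p, r) \<in> diff_rel G" using c e by (simp add: diff_rel_def)
  qed
next
  show "sym (diff_rel G)"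
  proof (rule symI)
    fix p q assume "(p, q) \<in> diff_rel G"
    then show "(q, p) \<in> diff_rel G" by (cases p; cases q) (simp add: diff_rel_def)
  qed
qed (auto simp: diff_rel_def refl_on_def)

lemma (in comm_monoid_cancel) diff_class_eq_iff:
  assumes "x \<in> carrier G" "y \<in> carrier G" "x' \<in> carrier G" "y' \<in> carrier G"
  shows "diff_class G x y = diff_class G x' y' \<longleftrightarrow> x \<otimes> y' = x' \<otimes> y"
  using eq_equiv_class_iff[OF equiv_diff_rel, of "(x, y)" "(x', y')"] assms
  by (simp add: diff_class_def diff_rel_def)

lemma (in comm_monoid_cancel) carrier_gp:
  "carrier (gp G) = {diff_class G x y |x y. x \<in> carrier G \<and> y \<in> carrier G}"
  by (auto simp: gp_def quotient_def diff_class_def)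

lemma (in comm_monoid_cancel) mult_gp:
  assumes c: "x \<in> carrier G" "y \<in> carrier G" "x' \<in> carrier G" "y' \<in> carrier G"
  shows "diff_class G x y \<otimes>\<^bsub>gp G\<^esub> diff_class G x' y' = diff_class G (x \<otimes> x') (y \<otimes> y')"
proof -
  have "diff_class G (u \<otimes> u') (v \<otimes> v') = diff_class G (x \<otimes> x') (y \<otimes> y')"
    if "(u, v) \<in> diff_class G x y" "(u', v') \<in> diff_class G x' y'" for u v u' v'
  proof -
    have d: "u \<in> carrier G" "v \<in> carrier G" "u' \<in> carrier G" "v' \<in> carrier G"
      and 1: "x \<otimes> v = u \<otimes> y" and 2: "x' \<otimes> v' = u' \<otimes> y'"
      using that by (auto simp: diff_class_def diff_rel_def)
    have "(u \<otimes> u') \<otimes> (y \<otimes> y') = (u \<otimes> y) \<otimes> (u' \<otimes> y')" using c d by (simp add: m_ac)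
    also have "\<dots> = (x \<otimes> v) \<otimes> (x' \<otimes> v')" by (simp add: 1 2)
    also have "\<dots> = (x \<otimes> x') \<otimes> (v \<otimes> v')" using c d by (simp add: m_ac)
    finally show ?thesis using c d by (simp add: diff_class_eq_iff)
  qed
  then have "diff_class G x y \<otimes>\<^bsub>gp G\<^esub> diff_class G x' y' =
      (\<Union>p\<in>diff_class G x y. \<Union>q\<in>diff_class G x' y'. diff_class G (x \<otimes> x') (y \<otimes> y'))"
    unfolding gp_def by (simp add: case_prod_beta)
  moreover have "(x, y) \<in> diff_class G x y" "(x', y') \<in> diff_class G x' y'"
    using c by (auto simp: diff_class_def diff_rel_def)
  ultimately show ?thesis
    by auto
qed

lemma one_gp: "\<one>\<^bsub>gp M\<^esub> = diff_class M \<one>\<^bsub>M\<^esub> \<one>\<^bsub>M\<^esub>"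
  by (simp add: gp_def)

lemma (in comm_monoid_cancel) comm_group_gp: "comm_group (gp G)"
proof (rule comm_groupI)
  fix P assume "P \<in> carrier (gp G)"
  then obtain x y where c: "x \<in> carrier G" "y \<in> carrier G" and P: "P = diff_class G x y"
    by (auto simp: carrier_gp)
  have "diff_class G y x \<otimes>\<^bsub>gp G\<^esub> P = \<one>\<^bsub>gp G\<^esub>"
    using c by (simp add: P mult_gp one_gp diff_class_eq_iff m_comm)
  moreover have "diff_class G y x \<in> carrier (gp G)" using c by (auto simp: carrier_gp)
  ultimately show "\<exists>Q\<in>carrier (gp G). Q \<otimes>\<^bsub>gp G\<^esub> P = \<one>\<^bsub>gp G\<^esub>" by blast
next
  show "\<one>\<^bsub>gp G\<^esub> \<in> carrier (gp G)" by (auto simp: carrier_gp one_gp)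
next
  fix P Q assume "P \<in> carrier (gp G)" "Q \<in> carrier (gp G)"
  then obtain x y x' y' where "x \<in> carrier G" "y \<in> carrier G" "x' \<in> carrier G" "y' \<in> carrier G"
    and "P = diff_class G x y" "Q = diff_class G x' y'"
    by (auto simp: carrier_gp)
  then show "P \<otimes>\<^bsub>gp G\<^esub> Q \<in> carrier (gp G)" and "P \<otimes>\<^bsub>gp G\<^esub> Q = Q \<otimes>\<^bsub>gp G\<^esub> P"
    unfolding carrier_gp by (auto simp: mult_gp m_comm)
next
  fix P assume "P \<in> carrier (gp G)"
  then show "\<one>\<^bsub>gp G\<^esub> \<otimes>\<^bsub>gp G\<^esub> P = P"
    by (auto simp: carrier_gp mult_gp one_gp)
next
  fix P Q R assume "P \<in> carrier (gp G)" "Q \<in> carrier (gp G)" "R \<in> carrier (gp G)"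
  then obtain x y x' y' x'' y'' where "x \<in> carrier G" "y \<in> carrier G" "x' \<in> carrier G"
    "y' \<in> carrier G" "x'' \<in> carrier G" "y'' \<in> carrier G"
    and "P = diff_class G x y" "Q = diff_class G x' y'" "R = diff_class G x'' y''"
    by (auto simp: carrier_gp)
  then show "P \<otimes>\<^bsub>gp G\<^esub> Q \<otimes>\<^bsub>gp G\<^esub> R = P \<otimes>\<^bsub>gp G\<^esub> (Q \<otimes>\<^bsub>gp G\<^esub> R)"
    by (simp add: mult_gp m_assoc)
qed

lemma (in comm_monoid_cancel) gp_embed_hom: "gp_embed G \<in> hom G (gp G)"
  unfolding gp_embed_def by (rule homI) (auto simp: carrier_gp mult_gp)

lemma (in comm_monoid_cancel) inj_on_gp_embed: "inj_on (gp_embed G) (carrier G)"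
  by (auto simp: gp_embed_def inj_on_def diff_class_eq_iff)

lemma (in comm_monoid) mset_val_superset:
  assumes "finite A" "set_mset z \<subseteq> A" "A \<subseteq> carrier G"
  shows "mset_val G z = finprod G (\<lambda>a. a [^] count z a) A"
  unfolding mset_val_def using assms
  by (intro finprod_mono_neutral_cong_left) (auto simp: not_in_iff)

lemma (in comm_monoid) mset_val_empty: "mset_val G {#} = \<one>"
  by (simp add: mset_val_def)

lemma (in comm_monoid) mset_val_single: "a \<in> carrier G \<Longrightarrow> mset_val G {#a#} = a"
  by (simp add: mset_val_def)

lemma (in comm_monoid) mset_val_union:
  assumes "set_mset z \<subseteq> carrier G" "set_mset w \<subseteq> carrier G"
  shows "mset_val G (z + w) = mset_val G z \<otimes> mset_val G w"
proof -
  let ?A = "set_mset z \<union> set_mset w"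
  have "mset_val G (z + w) = finprod G (\<lambda>a. a [^] count z a \<otimes> a [^] count w a) ?A"
    unfolding mset_val_def using assms by (intro finprod_cong') (auto simp: nat_pow_mult)
  also have "\<dots> = finprod G (\<lambda>a. a [^] count z a) ?A \<otimes> finprod G (\<lambda>a. a [^] count w a) ?A"
    using assms by (intro finprod_multf) auto
  also have "\<dots> = mset_val G z \<otimes> mset_val G w"
    using assms by (simp add: mset_val_superset[where A = ?A])
  finally show ?thesis .
qed

lemma (in comm_monoid) mult_reduced:
  assumes "x \<in> carrier G" "y \<in> carrier G"
  shows "(Units G #> x) \<otimes>\<^bsub>reduced G\<^esub> (Units G #> y) = Units G #> (x \<otimes> y)"
proof -
  have "Units G #> (x \<otimes> y) \<subseteq> (Units G #> x) <#> (Units G #> y)"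
  proof
    fix w assume "w \<in> Units G #> (x \<otimes> y)"
    then obtain u where u: "u \<in> Units G" and w: "w = u \<otimes> (x \<otimes> y)"
      unfolding r_coset_def by blast
    have "w = (u \<otimes> x) \<otimes> (\<one> \<otimes> y)" using u assms by (simp add: w m_assoc Units_closed)
    then show "w \<in> (Units G #> x) <#> (Units G #> y)"
      unfolding set_mult_def r_coset_def using u Units_one_closed by blast
  qed
  moreover have "(Units G #> x) <#> (Units G #> y) \<subseteq> Units G #> (x \<otimes> y)"
  proof
    fix w assume "w \<in> (Units G #> x) <#> (Units G #> y)"
    then obtain u v where uv: "u \<in> Units G" "v \<in> Units G" and w: "w = (u \<otimes> x) \<otimes> (v \<otimes> y)"
      unfolding set_mult_def r_coset_def by blast
    have "w = (u \<otimes> v) \<otimes> (x \<otimes> y)" using uv assms by (simp add: w m_ac Units_closed)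
    moreover have "u \<otimes> v \<in> Units G" using uv by (rule Units_m_closed)
    ultimately show "w \<in> Units G #> (x \<otimes> y)"
      unfolding r_coset_def by blast
  qed
  ultimately show ?thesis
    unfolding reduced_def mult_FactGroup by (intro subset_antisym)
qed

lemma (in comm_monoid) comm_monoid_reduced: "comm_monoid (reduced G)"
proof -
  have car: "carrier (reduced G) = (\<lambda>x. Units G #> x) ` carrier G"
    by (simp add: reduced_def carrier_FactGroup)
  have unit: "\<one>\<^bsub>reduced G\<^esub> = Units G #> \<one>"
    by (auto simp: reduced_def r_coset_def Units_closed)
  show ?thesis
    by (rule comm_monoidI) (auto simp: car unit mult_reduced m_ac)
qed

end

theory Submission
  imports Defs
begin

text \<open>
  A monoid is a BFM exactly when, for each of its elements \<open>b\<close>, the number of terms in a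
  representation of \<open>b\<close> as a sum of noninvertible elements is bounded
  (\<open>bfm_iff_nonunit_sums_bounded\<close>). This criterion passes from a monoid \<open>S\<close> to a submonoid \<open>N\<close>
  as soon as the noninvertible elements of \<open>N\<close> are still noninvertible in \<open>S\<close>
  (\<open>nonunit_sums_bounded_descend\<close>). Hence it suffices to enlarge a given submonoid \<open>N\<close> of \<open>M\<close> to
  an undermonoid \<open>S\<close> of \<open>M\<close> without making any noninvertible element of \<open>N\<close> invertible.

  By Zorn's lemma there is a maximal submonoid \<open>S\<close> between \<open>N\<close> and \<open>M\<close> with this property; the
  point is that maximality already makes \<open>S\<close> an undermonoid. Written additively: if
  \<open>m \<in> M - S\<close>, then adjoining \<open>m\<close> inverts some noninvertible \<open>x \<in> N\<close>, that is,
  \<open>x + s + k m = 0\<close> with \<open>s \<in> S\<close> and \<open>k > 0\<close>. So \<open>m\<close> is invertible in \<open>M\<close>. If \<open>- m\<close> were outside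
  \<open>S\<close> as well, then likewise \<open>x' + s' - l m = 0\<close> with \<open>l > 0\<close>, and \<open>l\<close> times the first equation
  plus \<open>k\<close> times the second one reads \<open>l x + l s + k (x' + s') = 0\<close>. This exhibits an inverse of
  \<open>x\<close> inside \<open>S\<close>, which is impossible. Therefore \<open>m \<in> S\<close> or \<open>- m \<in> S\<close> for every \<open>m \<in> M\<close>
  (\<open>maximal_extension_total\<close>), and \<open>S\<close> generates the Grothendieck group of \<open>M\<close>.
\<close>

section \<open>Sums of multisets\<close>

context comm_monoid
begin

lemma mset_val_add_mset:
  assumes "a \<in> carrier G" "set_mset z \<subseteq> carrier G"
  shows "mset_val G (add_mset a z) = a \<otimes> mset_val G z"
  using mset_val_union[of "{#a#}" z] assms by (simp add: mset_val_single)

lemma mset_val_closed: "set_mset z \<subseteq> carrier G \<Longrightarrow> mset_val G z \<in> carrier G"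
  by (induction z) (auto simp: mset_val_empty mset_val_add_mset)

end

lemma (in comm_monoid_cancel) submonoid_is_comm_monoid_cancel:
  assumes "submonoid N G"
  shows "comm_monoid_cancel (G\<lparr>carrier := N\<rparr>)"
proof (rule comm_monoid_cancelI)
  show "comm_monoid (G\<lparr>carrier := N\<rparr>)" by (rule submonoid_is_comm_monoid[OF assms])
qed (use submonoid.subset[OF assms] in \<open>auto dest: r_cancel\<close>)

lemma (in comm_monoid) mset_val_submonoid:
  assumes "submonoid N G" "set_mset z \<subseteq> N"
  shows "mset_val (G\<lparr>carrier := N\<rparr>) z = mset_val G z"
proof -
  interpret N: comm_monoid "G\<lparr>carrier := N\<rparr>" by (rule submonoid_is_comm_monoid[OF assms(1)])
  have "N \<subseteq> carrier G" by (rule submonoid.subset[OF assms(1)])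
  with assms(2) show ?thesis
  proof (induction z)
    case empty
    then show ?case using N.mset_val_empty by (simp add: mset_val_empty)
  next
    case (add a z)
    have "mset_val (G\<lparr>carrier := N\<rparr>) (add_mset a z) = a \<otimes> mset_val (G\<lparr>carrier := N\<rparr>) z"
      using N.mset_val_add_mset[of a z] add.prems by simp
    also have "\<dots> = mset_val G (add_mset a z)"
      using add.IH add.prems mset_val_add_mset[of a z] by (simp add: subset_iff)
    finally show ?case .
  qed
qed

section \<open>The reduced monoid\<close>

context comm_monoid_cancel
begin

lemma carrier_reduced: "carrier (reduced G) = (\<lambda>x. Units G #> x) ` carrier G"
  by (simp add: reduced_def carrier_FactGroup)

lemma one_reduced: "\<one>\<^bsub>reduced G\<^esub> = Units G #> \<one>"
  by (auto simp: reduced_def r_coset_def Units_closed)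

text \<open>
  Although \<open>G\<close> need not be a group, its units act on it by translations, and the cosets are the
  orbits of that action.
\<close>

lemma Units_coset_eq_iff:
  assumes "x \<in> carrier G" "y \<in> carrier G"
  shows "Units G #> x = Units G #> y \<longleftrightarrow> (\<exists>u\<in>Units G. x = u \<otimes> y)"
proof
  assume "Units G #> x = Units G #> y"
  moreover have "x \<in> Units G #> x"
    using assms(1) unfolding r_coset_def by (auto intro!: bexI[of _ \<one>])
  ultimately show "\<exists>u\<in>Units G. x = u \<otimes> y" by (auto simp: r_coset_def)
next
  assume "\<exists>u\<in>Units G. x = u \<otimes> y"
  then obtain u where u: "u \<in> Units G" "x = u \<otimes> y" by blast
  have "v \<otimes> x \<in> Units G #> y" if "v \<in> Units G" for v
    using u assms that Units_m_closed[of v u]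
    by (auto simp: r_coset_def Units_closed m_assoc[symmetric])
  moreover have "v \<otimes> y \<in> Units G #> x" if "v \<in> Units G" for v
  proof -
    have "v \<otimes> y = (v \<otimes> inv u) \<otimes> x"
      using u assms that by (simp add: Units_closed m_assoc) (simp add: m_assoc[symmetric] Units_closed)
    moreover have "v \<otimes> inv u \<in> Units G" using u that by simp
    ultimately show ?thesis by (auto simp: r_coset_def)
  qed
  ultimately show "Units G #> x = Units G #> y" by (auto simp: r_coset_def)
qed

lemma coset_in_Units_reduced_iff:
  assumes "x \<in> carrier G"
  shows "Units G #> x \<in> Units (reduced G) \<longleftrightarrow> x \<in> Units G"
proof
  interpret R: comm_monoid "reduced G" by (rule comm_monoid_reduced)
  assume "Units G #> x \<in> Units (reduced G)"
  then obtain y where y: "y \<in> carrier G" "(Units G #> x) \<otimes>\<^bsub>reduced G\<^esub> (Units G #> y) = Units G #> \<one>"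
    unfolding Units_def[of "reduced G"] by (auto simp: carrier_reduced one_reduced)
  then have "x \<otimes> y \<in> Units G"
    using assms by (auto simp: mult_reduced Units_coset_eq_iff Units_closed)
  then show "x \<in> Units G" using assms y(1) by (meson unit_factor)
next
  assume "x \<in> Units G"
  then have "Units G #> x = \<one>\<^bsub>reduced G\<^esub>"
    using assms by (auto simp: one_reduced Units_coset_eq_iff Units_closed)
  then show "Units G #> x \<in> Units (reduced G)"
    using monoid.Units_one_closed comm_monoid_reduced comm_monoid.axioms(1) by metis
qed

lemma coset_of_atom:
  assumes "a \<in> atoms G"
  shows "Units G #> a \<in> atoms (reduced G)"
proof -
  have a: "a \<in> carrier G" "a \<notin> Units G"
    and at: "\<And>b c. b \<in> carrier G \<Longrightarrow> c \<in> carrier G \<Longrightarrow> a = b \<otimes> c \<Longrightarrow> b \<in> Units G \<or> c \<in> Units G"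
    using assms by (auto simp: atoms_def)
  have "b \<in> Units G \<or> c \<in> Units G"
    if bc: "b \<in> carrier G" "c \<in> carrier G"
      and eq: "Units G #> a = (Units G #> b) \<otimes>\<^bsub>reduced G\<^esub> (Units G #> c)" for b c
  proof -
    obtain u where u: "u \<in> Units G" "a = u \<otimes> (b \<otimes> c)"
      using eq a bc by (auto simp: mult_reduced Units_coset_eq_iff)
    have "a = (b \<otimes> u) \<otimes> c" using u bc by (simp add: m_ac Units_closed)
    then have "b \<otimes> u \<in> Units G \<or> c \<in> Units G" using at u bc by (simp add: Units_closed)
    then show ?thesis using unit_factor[of b u] u bc by (auto simp: Units_closed)
  qed
  then show ?thesis using a
    unfolding atoms_def by (auto simp: carrier_reduced coset_in_Units_reduced_iff)
qed

lemma mset_val_cosets: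
  assumes "set_mset z \<subseteq> carrier G"
  shows "mset_val (reduced G) (image_mset (\<lambda>x. Units G #> x) z) = Units G #> mset_val G z"
proof -
  interpret R: comm_monoid "reduced G" by (rule comm_monoid_reduced)
  from assms show ?thesis
  proof (induction z)
    case empty
    then show ?case by (simp add: R.mset_val_empty mset_val_empty one_reduced)
  next
    case (add a z)
    have "set_mset (image_mset (\<lambda>x. Units G #> x) z) \<subseteq> carrier (reduced G)"
      using add.prems by (auto simp: carrier_reduced)
    with add show ?case
      by (simp add: R.mset_val_add_mset mset_val_add_mset carrier_reduced mult_reduced mset_val_closed)
  qed
qed

text \<open>
  Lengths are defined by factorizations in the reduced monoid; passing to cosets turns a
  factorization in the monoid itself into one of these.
\<close>

lemma size_in_lengths:
  assumes "set_mset z \<subseteq> atoms G"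
  shows "size z \<in> lengths G (mset_val G z)"
proof -
  have "set_mset z \<subseteq> carrier G" using assms by (auto simp: atoms_def)
  then have "image_mset (\<lambda>x. Units G #> x) z \<in> factorizations G (mset_val G z)"
    using assms
    by (auto simp: factorizations_def factorization_monoid_def mset_val_cosets coset_of_atom)
  then show ?thesis unfolding lengths_def by force
qed

end

section \<open>Bounded factorization by counting noninvertible summands\<close>

definition nonunit_sums_bounded :: "('a, 'b) monoid_scheme \<Rightarrow> bool" where
  "nonunit_sums_bounded M \<longleftrightarrow> (\<forall>b\<in>carrier M. \<exists>n. \<forall>z.
     set_mset z \<subseteq> carrier M - Units M \<longrightarrow> mset_val M z = b \<longrightarrow> size z \<le> n)"

context comm_monoid_cancel
begin

text \<open>
  The empty multiset has the invertible sum \<open>\<one>\<close>, so replacing a noninvertible term by atoms uses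
  at least one atom; refining a sum cannot shorten it.
\<close>

lemma refine_into_atoms:
  assumes "atomic_monoid G" "set_mset z \<subseteq> carrier G - Units G"
  shows "\<exists>w. set_mset w \<subseteq> atoms G \<and> mset_val G w = mset_val G z \<and> size z \<le> size w"
  using assms(2)
proof (induction z)
  case empty
  show ?case by (rule exI[of _ "{#}"]) simp
next
  case (add a z)
  then obtain w where w: "set_mset w \<subseteq> atoms G" "mset_val G w = mset_val G z" "size z \<le> size w"
    by auto
  obtain v where v: "set_mset v \<subseteq> atoms G" "a = mset_val G v"
    using assms(1) add.prems unfolding atomic_monoid_def by auto
  have "v \<noteq> {#}" using v add.prems by (auto simp: mset_val_empty)
  then have "size v \<ge> 1" by (cases v) auto
  moreover have "set_mset v \<subseteq> carrier G" "set_mset w \<subseteq> carrier G"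
    using v w by (auto simp: atoms_def)
  moreover have "a \<in> carrier G" "set_mset z \<subseteq> carrier G"
    using add.prems by auto
  ultimately show ?case using v w
    by (intro exI[of _ "v + w"]) (auto simp: mset_val_union mset_val_add_mset)
qed

text \<open>
  A longest representation of \<open>x\<close> as a sum of noninvertible elements consists of atoms, because
  splitting a term further would make it longer.
\<close>

lemma nonunit_sums_bounded_imp_atomic:
  assumes "nonunit_sums_bounded G"
  shows "atomic_monoid G"
  unfolding atomic_monoid_def
proof (intro ballI disjCI)
  fix x assume x: "x \<in> carrier G" "\<nexists>z. set_mset z \<subseteq> atoms G \<and> x = mset_val G z"
  let ?P = "\<lambda>z. set_mset z \<subseteq> carrier G - Units G \<and> mset_val G z = x"
  show "x \<in> Units G"
  proof (rule ccontr)
    assume "x \<notin> Units G"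
    then have "?P {#x#}" using x by (simp add: mset_val_single)
    moreover obtain n where "\<And>z. ?P z \<Longrightarrow> size z \<le> n"
      using assms x(1) unfolding nonunit_sums_bounded_def by blast
    ultimately obtain z where z: "?P z" and max: "\<And>w. ?P w \<Longrightarrow> size w \<le> size z"
      using ex_has_greatest_nat[of ?P "{#x#}" size "Suc n"] by (auto simp: less_Suc_eq_le)
    have "a \<in> atoms G" if a: "a \<in># z" for a
    proof (rule ccontr)
      assume "a \<notin> atoms G"
      then obtain b c where bc: "b \<in> carrier G - Units G" "c \<in> carrier G - Units G" "a = b \<otimes> c"
        using z a unfolding atoms_def by blast
      obtain w where w: "z = add_mset a w" using a by (metis insert_DiffM)
      have "?P (add_mset b (add_mset c w))"
        using z bc w by (auto simp: mset_val_add_mset mset_val_closed m_assoc Diff_subset subset_iff)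
      then have "size (add_mset b (add_mset c w)) \<le> size z" by (rule max)
      then show False using w by simp
    qed
    then show False using x(2) z by blast
  qed
qed

lemma bfm_imp_nonunit_sums_bounded:
  assumes "bfm G"
  shows "nonunit_sums_bounded G"
  unfolding nonunit_sums_bounded_def
proof (intro ballI exI allI impI)
  fix b z assume b: "b \<in> carrier G"
    and z: "set_mset z \<subseteq> carrier G - Units G" "mset_val G z = b"
  obtain w where w: "set_mset w \<subseteq> atoms G" "mset_val G w = b" "size z \<le> size w"
    using refine_into_atoms[OF _ z(1)] assms z(2) unfolding bfm_def by auto
  have "size w \<in> lengths G b" using size_in_lengths[OF w(1)] w(2) by simp
  then have "size w \<le> Max (lengths G b)" using assms b unfolding bfm_def by simp
  then show "size z \<le> Max (lengths G b)" using w(3) by simp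
qed

text \<open>
  Choosing representatives of the cosets in a factorization gives a sum that agrees with \<open>b\<close> up to
  a unit. The unit is absorbed into one of the terms, so there has to be one: for a unit
  \<open>b \<noteq> \<one>\<close>, the empty factorization has no lift with sum \<open>b\<close>.
\<close>

lemma lift_factorization:
  assumes b: "b \<in> carrier G" and z: "z \<in> factorizations G b" and ne: "z \<noteq> {#}"
  shows "\<exists>w. set_mset w \<subseteq> carrier G - Units G \<and> mset_val G w = b \<and> size w = size z"
proof -
  let ?c = "\<lambda>x. Units G #> x"
  have "set_mset z \<subseteq> ?c ` (carrier G - Units G)"
    using z unfolding factorizations_def factorization_monoid_def atoms_def
    by (auto simp: carrier_reduced coset_in_Units_reduced_iff)
  then have "\<exists>w. set_mset w \<subseteq> carrier G - Units G \<and> image_mset ?c w = z"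
  proof (induction z)
    case empty
    then show ?case by simp
  next
    case (add A z)
    then obtain a w where "a \<in> carrier G - Units G" "A = ?c a"
      "set_mset w \<subseteq> carrier G - Units G" "image_mset ?c w = z" by auto
    then show ?case by (intro exI[of _ "add_mset a w"]) auto
  qed
  then obtain w where w: "set_mset w \<subseteq> carrier G - Units G" "image_mset ?c w = z" by blast
  have wc: "set_mset w \<subseteq> carrier G" using w by auto
  have "?c b = ?c (mset_val G w)"
    using z mset_val_cosets[OF wc] w(2) by (simp add: factorizations_def)
  then obtain u where u: "u \<in> Units G" "b = u \<otimes> mset_val G w"
    using b mset_val_closed[OF wc] by (auto simp: Units_coset_eq_iff)
  obtain a v where v: "w = add_mset a v" using ne w(2) by (cases w) auto
  have a: "a \<in> carrier G - Units G" and vc: "set_mset v \<subseteq> carrier G - Units G"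
    using w v by auto
  have "u \<otimes> a \<notin> Units G" using a u unit_factor[of a u] by (auto simp: m_comm Units_closed)
  moreover have "mset_val G (add_mset (u \<otimes> a) v) = b"
    using u a vc v
    by (subst mset_val_add_mset) (auto simp: mset_val_add_mset subset_iff m_assoc Units_closed mset_val_closed)
  moreover have "size (add_mset (u \<otimes> a) v) = size z" using w v by auto
  ultimately show ?thesis using u a vc by (intro exI[of _ "add_mset (u \<otimes> a) v"]) (auto simp: Units_closed)
qed

text \<open>
  The right-hand side mentions neither atoms nor the reduced monoid, which is what allows the
  comparison of a submonoid with a larger one: their atoms may be unrelated.
\<close>

lemma bfm_iff_nonunit_sums_bounded: "bfm G \<longleftrightarrow> nonunit_sums_bounded G"
proof
  assume B: "nonunit_sums_bounded G"
  then have at: "atomic_monoid G" by (rule nonunit_sums_bounded_imp_atomic)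
  have "finite (lengths G b) \<and> lengths G b \<noteq> {}" if b: "b \<in> carrier G" for b
  proof
    obtain n where n: "\<And>z. set_mset z \<subseteq> carrier G - Units G \<Longrightarrow> mset_val G z = b \<Longrightarrow> size z \<le> n"
      using B b unfolding nonunit_sums_bounded_def by blast
    have "size z \<le> n" if "z \<in> factorizations G b" for z
      using lift_factorization[OF b that] n by (cases "z = {#}") (auto, metis)
    then have "lengths G b \<subseteq> {..n}" by (auto simp: lengths_def)
    then show "finite (lengths G b)" by (rule finite_subset) simp
    show "lengths G b \<noteq> {}"
    proof (cases "b \<in> Units G")
      case True
      then have "Units G #> \<one> = Units G #> b" 
        using b by (subst Units_coset_eq_iff) (auto intro!: bexI[of _ "inv b"])
      then have "{#} \<in> factorizations G b"
        using comm_monoid.mset_val_empty[OF comm_monoid_reduced]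
        by (simp add: factorizations_def factorization_monoid_def one_reduced)
      then show ?thesis by (auto simp: lengths_def)
    next
      case False
      then show ?thesis using at b size_in_lengths unfolding atomic_monoid_def by blast
    qed
  qed
  then show "bfm G" using at by (auto simp: bfm_def Suc_le_eq card_gt_0_iff)
qed (rule bfm_imp_nonunit_sums_bounded)

section \<open>Enlarging a submonoid to an undermonoid\<close>

text \<open>
  Since inverses are unique, this says for submonoids \<open>N \<subseteq> S\<close> that each noninvertible element of
  \<open>N\<close> is noninvertible in \<open>S\<close>. Its universal form makes it stable under unions of chains.
\<close>

definition inverse_closed_in :: "'a set \<Rightarrow> 'a set \<Rightarrow> bool" where
  "inverse_closed_in N S \<longleftrightarrow> (\<forall>x\<in>N. \<forall>y\<in>S. x \<otimes> y = \<one> \<longrightarrow> y \<in> N)"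

lemma submonoid_nat_pow:
  assumes "submonoid S G" "x \<in> S"
  shows "x [^] (k::nat) \<in> S"
  using assms by (induction k) (auto simp: submonoid.one_closed submonoid.m_closed)

lemma submonoid_adjoin:
  assumes S: "submonoid S G" and m: "m \<in> carrier G"
  shows "submonoid {s \<otimes> m [^] (k::nat) |s k. s \<in> S} G"
proof
  have sub: "S \<subseteq> carrier G" by (rule submonoid.subset[OF S])
  then show "{s \<otimes> m [^] (k::nat) |s k. s \<in> S} \<subseteq> carrier G" using m by auto
  show "\<one> \<in> {s \<otimes> m [^] (k::nat) |s k. s \<in> S}"
    using submonoid.one_closed[OF S] by (auto intro!: exI[of _ \<one>] exI[of _ "0::nat"])
  fix x y assume "x \<in> {s \<otimes> m [^] (k::nat) |s k. s \<in> S}" "y \<in> {s \<otimes> m [^] (k::nat) |s k. s \<in> S}"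
  then obtain s k t l where st: "s \<in> S" "t \<in> S" and xy: "x = s \<otimes> m [^] (k::nat)" "y = t \<otimes> m [^] (l::nat)"
    by blast
  have "s \<in> carrier G" "t \<in> carrier G" using st sub by auto
  then have "x \<otimes> y = (s \<otimes> t) \<otimes> m [^] (k + l)"
    using m by (simp add: xy nat_pow_mult[symmetric] m_ac)
  then show "x \<otimes> y \<in> {s \<otimes> m [^] (k::nat) |s k. s \<in> S}"
    using submonoid.m_closed[OF S st] by blast
qed

lemma exists_maximal_extension:
  assumes N: "submonoid N G"
  obtains S where "submonoid S G" "N \<subseteq> S" "inverse_closed_in N S"
    "\<And>T. submonoid T G \<Longrightarrow> S \<subseteq> T \<Longrightarrow> inverse_closed_in N T \<Longrightarrow> T = S"
proof -
  let ?F = "{S. submonoid S G \<and> N \<subseteq> S \<and> inverse_closed_in N S}"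
  have "\<exists>S\<in>?F. \<forall>T\<in>?F. S \<subseteq> T \<longrightarrow> T = S"
  proof (rule subset_Zorn_nonempty)
    show "?F \<noteq> {}" using N by (auto simp: inverse_closed_in_def)
    fix C assume ne: "C \<noteq> {}" and C: "subset.chain ?F C"
    have sub: "\<And>S. S \<in> C \<Longrightarrow> submonoid S G" and N_sub: "\<And>S. S \<in> C \<Longrightarrow> N \<subseteq> S"
      and inv: "\<And>S. S \<in> C \<Longrightarrow> inverse_closed_in N S"
      using C by (auto simp: subset.chain_def)
    have "submonoid (\<Union>C) G"
    proof
      show "\<Union>C \<subseteq> carrier G" using submonoid.subset[OF sub] by blast
      show "\<one> \<in> \<Union>C" using ne submonoid.one_closed[OF sub] by blast
      fix x y assume "x \<in> \<Union>C" "y \<in> \<Union>C"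
      then obtain S T where "S \<in> C" "x \<in> S" "T \<in> C" "y \<in> T" by blast
      moreover from this have "S \<subseteq> T \<or> T \<subseteq> S" using C by (auto simp: subset_chain_def)
      ultimately show "x \<otimes> y \<in> \<Union>C" using submonoid.m_closed[OF sub] by blast
    qed
    then show "\<Union>C \<in> ?F" using ne N_sub inv unfolding inverse_closed_in_def by blast
  qed
  then obtain S where S: "S \<in> ?F" and max: "\<forall>T\<in>?F. S \<subseteq> T \<longrightarrow> T = S" ..
  have "N \<subseteq> S" using S by simp
  show ?thesis
  proof (rule that)
    show "submonoid S G" "N \<subseteq> S" "inverse_closed_in N S" using S by simp_all
    fix T assume "submonoid T G" "S \<subseteq> T" "inverse_closed_in N T"
    then have "T \<in> ?F" using \<open>N \<subseteq> S\<close> by simp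
    show "T = S" by (rule mp[OF bspec[OF max \<open>T \<in> ?F\<close>] \<open>S \<subseteq> T\<close>])
  qed
qed

text \<open>
  If neither \<open>m\<close> nor \<open>inv m\<close> were in \<open>S\<close>, then adjoining either of them would invert a
  noninvertible element of \<open>N\<close>. In suitable powers of the two resulting relations the factors
  \<open>m\<close> and \<open>inv m\<close> cancel, which leaves an inverse of a noninvertible element of \<open>N\<close> that is
  already in \<open>S\<close>.
\<close>

lemma maximal_extension_total:
  assumes S: "submonoid S G" "N \<subseteq> S" "inverse_closed_in N S"
    and max: "\<And>T. submonoid T G \<Longrightarrow> S \<subseteq> T \<Longrightarrow> inverse_closed_in N T \<Longrightarrow> T = S"
    and m: "m \<in> carrier G" "m \<notin> S"
  shows "m \<in> Units G \<and> inv m \<in> S"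
proof -
  have sub: "S \<subseteq> carrier G" by (rule submonoid.subset[OF S(1)])
  have obstruction: "\<exists>x\<in>N. \<exists>s\<in>S. \<exists>k>0. x \<otimes> (s \<otimes> m [^] (k::nat)) = \<one> \<and> s \<otimes> m [^] k \<notin> N"
    if m: "m \<in> carrier G" "m \<notin> S" for m
  proof -
    let ?T = "{s \<otimes> m [^] (k::nat) |s k. s \<in> S}"
    have "s \<in> ?T" if "s \<in> S" for s
      using that sub by (auto intro!: exI[of _ s] exI[of _ "0::nat"])
    moreover have "m \<in> ?T"
      using m submonoid.one_closed[OF S(1)] by (auto intro!: exI[of _ \<one>] exI[of _ "1::nat"])
    ultimately have "\<not> inverse_closed_in N ?T"
      using max[OF submonoid_adjoin[OF S(1) m(1)]] m(2) by blast
    then obtain x s k where x: "x \<in> N" "s \<in> S" "x \<otimes> (s \<otimes> m [^] (k::nat)) = \<one>" "s \<otimes> m [^] k \<notin> N"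
      unfolding inverse_closed_in_def by blast
    \<comment> \<open>For \<open>k = 0\<close> the inverse of \<open>x\<close> would already lie in \<open>S\<close>.\<close>
    have "k \<noteq> 0"
    proof
      assume "k = 0"
      then have "s \<otimes> m [^] k \<in> S" using x(2) sub by auto
      then show False using x S(3) unfolding inverse_closed_in_def by blast
    qed
    then show ?thesis using x by blast
  qed
  obtain x s k where x: "x \<in> N" "s \<in> S" and k: "k > 0"
    and eq: "x \<otimes> (s \<otimes> m [^] (k::nat)) = \<one>" and notN: "s \<otimes> m [^] k \<notin> N"
    using obstruction[OF m] by blast
  have xS: "x \<in> S" using x S(2) by blast
  have c: "x \<in> carrier G" "s \<in> carrier G" using xS x sub by auto
  have "m [^] k \<otimes> (x \<otimes> s) = \<one>" using eq c m by (simp add: m_ac)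
  then have "m [^] k \<in> Units G" using c m unit_factor[of "m [^] k" "x \<otimes> s"] by auto
  moreover obtain j where j: "k = Suc j" using k by (cases k) auto
  ultimately have "m \<in> Units G" using m unit_factor[of m "m [^] j"] by (simp add: m_comm)
  moreover have "inv m \<in> S"
  proof (rule ccontr)
    assume "inv m \<notin> S"
    then obtain x' s' l where x': "x' \<in> N" "s' \<in> S" and l: "l > 0"
      and eq': "x' \<otimes> (s' \<otimes> inv m [^] (l::nat)) = \<one>"
      using obstruction[of "inv m"] \<open>m \<in> Units G\<close> by auto
    obtain i where i: "l = Suc i" using l by (cases l) auto
    have x'S: "x' \<in> S" using x' S(2) by blast
    have c': "x' \<in> carrier G" "s' \<in> carrier G" using x'S x' sub by auto
    \<comment> \<open>\<open>?y\<close> is what remains, after splitting off one factor \<open>x\<close>, of the product of the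
      \<open>l\<close>-th power of \<open>eq\<close> and the \<open>k\<close>-th power of \<open>eq'\<close>; as \<open>i = l - 1\<close>, it needs \<open>l > 0\<close>.\<close>
    let ?t = "x' \<otimes> s'"
    let ?y = "x [^] i \<otimes> s [^] l \<otimes> ?t [^] k"
    have invm: "inv m \<in> carrier G" "m \<otimes> inv m = \<one>" using \<open>m \<in> Units G\<close> by auto
    let ?p = "m [^] (k * l)" and ?q = "inv m [^] (k * l)"
    have 1: "x [^] l \<otimes> s [^] l \<otimes> ?p = \<one>"
    proof -
      have "x [^] l \<otimes> s [^] l \<otimes> ?p = (x \<otimes> (s \<otimes> m [^] k)) [^] l"
        using c m by (simp add: nat_pow_distrib nat_pow_pow m_assoc)
      then show ?thesis by (simp add: eq)
    qed
    have 2: "?t [^] k \<otimes> ?q = \<one>"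
    proof -
      have "?t [^] k \<otimes> ?q = (x' \<otimes> (s' \<otimes> inv m [^] l)) [^] k"
        using c' invm(1) by (simp add: nat_pow_distrib nat_pow_pow m_assoc mult.commute)
      then show ?thesis by (simp add: eq')
    qed
    have 3: "?p \<otimes> ?q = \<one>"
      using m(1) invm by (simp flip: nat_pow_distrib)
    have "x \<otimes> ?y = x [^] l \<otimes> s [^] l \<otimes> ?t [^] k" using c c' by (simp add: i m_ac)
    also have "\<dots> = x [^] l \<otimes> s [^] l \<otimes> ?t [^] k \<otimes> (?p \<otimes> ?q)" using c c' by (simp add: 3)
    also have "\<dots> = (x [^] l \<otimes> s [^] l \<otimes> ?p) \<otimes> (?t [^] k \<otimes> ?q)"
      using c c' m(1) invm(1) by (simp add: m_ac)
    finally have "x \<otimes> ?y = \<one>" by (simp add: 1 2)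
    moreover have "?y \<in> S"
      using xS x'S x(2) x'(2) by (intro submonoid.m_closed[OF S(1)] submonoid_nat_pow[OF S(1)])
    ultimately have "?y \<in> N" using S(3) x(1) unfolding inverse_closed_in_def by blast
    moreover have "?y = s \<otimes> m [^] k"
      using \<open>x \<otimes> ?y = \<one>\<close> eq c c' m l_cancel[of x ?y "s \<otimes> m [^] k"] by simp
    ultimately show False using notN by simp
  qed
  ultimately show ?thesis by blast
qed

text \<open>
  In the Grothendieck group, an element of \<open>G\<close> is the image of an element of \<open>S\<close> or the inverse
  of such an image, and these images generate all differences.
\<close>

lemma undermonoid_if_total:
  assumes S: "submonoid S G"
    and total: "\<And>m. m \<in> carrier G \<Longrightarrow> m \<notin> S \<Longrightarrow> m \<in> Units G \<and> inv m \<in> S"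
  shows "undermonoid S G"
proof -
  interpret Q: comm_group "gp G" by (rule comm_group_gp)
  let ?H = "generate (gp G) (gp_embed G ` S)"
  have im: "gp_embed G ` S \<subseteq> carrier (gp G)"
    using submonoid.subset[OF S] gp_embed_hom by (auto simp: hom_def)
  have sg: "subgroup ?H (gp G)" by (rule Q.generate_is_subgroup[OF im])
  have neg: "inv\<^bsub>gp G\<^esub> (diff_class G x y) = diff_class G y x"
    if "x \<in> carrier G" "y \<in> carrier G" for x y
    using that by (intro Q.inv_equality) (auto simp: mult_gp one_gp diff_class_eq_iff carrier_gp m_comm)
  have emb: "diff_class G x \<one> \<in> ?H" if x: "x \<in> carrier G" for x
  proof (cases "x \<in> S")
    case True
    then show ?thesis by (auto simp: gp_embed_def intro: generate.incl)
  next
    case False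
    then have u: "x \<in> Units G" "inv x \<in> S" using total x by auto
    have "diff_class G (inv x) \<one> \<in> ?H"
      using u(2) by (auto simp: gp_embed_def intro: generate.incl)
    then have "diff_class G \<one> (inv x) \<in> ?H"
      using subgroup.m_inv_closed[OF sg] neg[of "inv x" \<one>] u(1) by force
    moreover have "diff_class G \<one> (inv x) = diff_class G x \<one>"
      using u(1) x by (subst diff_class_eq_iff) auto
    ultimately show ?thesis by simp
  qed
  have "diff_class G x y \<in> ?H" if "x \<in> carrier G" "y \<in> carrier G" for x y
  proof -
    have "diff_class G x \<one> \<otimes>\<^bsub>gp G\<^esub> diff_class G \<one> y \<in> ?H"
      using that emb[of x] emb[of y] neg[of y \<one>] subgroup.m_closed[OF sg] subgroup.m_inv_closed[OF sg]
      by force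
    then show ?thesis using that by (simp add: mult_gp)
  qed
  then have "carrier (gp G) \<subseteq> ?H" by (auto simp: carrier_gp)
  then show ?thesis using S subgroup.subset[OF sg] by (auto simp: undermonoid_def)
qed

lemma nonunit_sums_bounded_descend:
  assumes N: "submonoid N G" and S: "submonoid S G" and NS: "N \<subseteq> S"
    and inv: "inverse_closed_in N S" and B: "nonunit_sums_bounded (G\<lparr>carrier := S\<rparr>)"
  shows "nonunit_sums_bounded (G\<lparr>carrier := N\<rparr>)"
  unfolding nonunit_sums_bounded_def
proof
  have nonunit: "x \<in> S - Units (G\<lparr>carrier := S\<rparr>)" if "x \<in> N - Units (G\<lparr>carrier := N\<rparr>)" for x
    using that NS inv unfolding inverse_closed_in_def Units_def by auto
  fix b assume "b \<in> carrier (G\<lparr>carrier := N\<rparr>)"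
  then have "b \<in> S" using NS by auto
  moreover have "\<forall>b\<in>S. \<exists>n. \<forall>z. set_mset z \<subseteq> S - Units (G\<lparr>carrier := S\<rparr>) \<longrightarrow>
      mset_val (G\<lparr>carrier := S\<rparr>) z = b \<longrightarrow> size z \<le> n"
    using B by (simp add: nonunit_sums_bounded_def)
  ultimately have "\<exists>n. \<forall>z. set_mset z \<subseteq> S - Units (G\<lparr>carrier := S\<rparr>) \<longrightarrow>
      mset_val (G\<lparr>carrier := S\<rparr>) z = b \<longrightarrow> size z \<le> n"
    by (rule bspec[rotated])
  then obtain n where n: "\<And>z. set_mset z \<subseteq> S - Units (G\<lparr>carrier := S\<rparr>) \<Longrightarrow>
      mset_val (G\<lparr>carrier := S\<rparr>) z = b \<Longrightarrow> size z \<le> n"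
    by metis
  have "size z \<le> n" if z: "set_mset z \<subseteq> N - Units (G\<lparr>carrier := N\<rparr>)"
    "mset_val (G\<lparr>carrier := N\<rparr>) z = b" for z
  proof (rule n)
    show "set_mset z \<subseteq> S - Units (G\<lparr>carrier := S\<rparr>)" using z(1) nonunit by blast
    then show "mset_val (G\<lparr>carrier := S\<rparr>) z = b"
      using z mset_val_submonoid[OF S, of z] mset_val_submonoid[OF N, of z] by (simp add: subset_iff)
  qed
  then show "\<exists>n. \<forall>z. set_mset z \<subseteq> carrier (G\<lparr>carrier := N\<rparr>) - Units (G\<lparr>carrier := N\<rparr>) \<longrightarrow>
      mset_val (G\<lparr>carrier := N\<rparr>) z = b \<longrightarrow> size z \<le> n"
    by auto
qed

end

section \<open>The equivalence\<close>

theorem theorem5p4: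
  fixes M :: "('a, 'b) monoid_scheme"
  assumes "comm_monoid_cancel M"
  shows "hereditary_bfm M \<longleftrightarrow> (\<forall>N. undermonoid N M \<longrightarrow> bfm (M\<lparr>carrier := N\<rparr>))"
proof
  interpret comm_monoid_cancel M by (rule assms)
  assume under: "\<forall>N. undermonoid N M \<longrightarrow> bfm (M\<lparr>carrier := N\<rparr>)"
  have iff: "bfm (M\<lparr>carrier := N\<rparr>) \<longleftrightarrow> nonunit_sums_bounded (M\<lparr>carrier := N\<rparr>)"
    if "submonoid N M" for N
    using comm_monoid_cancel.bfm_iff_nonunit_sums_bounded[OF submonoid_is_comm_monoid_cancel[OF that]] .
  show "hereditary_bfm M"
    unfolding hereditary_bfm_def
  proof (intro allI impI)
    fix N assume N: "submonoid N M"
    obtain S where S: "submonoid S M" "N \<subseteq> S" "inverse_closed_in N S"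
      and max: "\<And>T. submonoid T M \<Longrightarrow> S \<subseteq> T \<Longrightarrow> inverse_closed_in N T \<Longrightarrow> T = S"
      using exists_maximal_extension[OF N] by blast
    have "undermonoid S M"
      using undermonoid_if_total[OF S(1)] maximal_extension_total[OF S max] by blast
    then have "nonunit_sums_bounded (M\<lparr>carrier := S\<rparr>)" using under iff S(1) by blast
    then show "bfm (M\<lparr>carrier := N\<rparr>)"
      using nonunit_sums_bounded_descend[OF N S] iff[OF N] by blast
  qed
qed (auto simp: hereditary_bfm_def undermonoid_def)

end
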